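(* The three-term recursion algorithm for evaluating $T_N(x)$ ($T_0=1$, $T_1=x$, $T_n=2xT_{n-1}-T_{n-2}$ for $n=2,\ldots,N$) is backward stable on $[-1,1]$ with a constant $L$ of order $N^2$, and it is backward stable for $|x|\le s_N=\frac{1}{\sqrt{N^2+1}}$ with a constant $L$ of order $N$. That is, there is an absolute constant $c>0$ such that for every $N\ge 2$ the computed value $\tilde T_N(x)$ satisfies $$|\tilde T_N(x)-T_N(x)| \le \epsilon_M\, c N^2\, C_N(x) + O(\epsilon_M^2)\quad\text{for all } x\in[-1,1],$$ $$|\tilde T_N(x)-T_N(x)| \le \epsilon_M\, c N\, C_N(x) + O(\epsilon_M^2)\quad\text{for all } |x|\le s_N,$$ where $x$ is assumed exactly representable in the floating point arithmetic.
   Context: $T_N$ denotes the Chebyshev polynomial of the first kind of degree $N$, defined by $T_0(x)=1$, $T_1(x)=x$, $T_n(x)=2xT_{n-1}(x)-T_{n-2}(x)$ for $n\ge 2$, and $C_N(x)=|T_N(x)|+|x\,T_N'(x)|$. An algorithm with computed values $\tilde T_N(x)$ is called backward stable (with respect to the data $x$) on a set $S\subseteq[-1,1]$ with constant $L=L(N)$ if $|\tilde T_N(x)-T_N(x)|\le\epsilon_M L\,C_N(x)+O(\epsilon_M^2)$ for $x\in S$, where $\epsilon_M$ is the machine precision. Floating point model: each arithmetic operation returns the exact result of the operation on its computed operands times $(1+\delta)$ with $|\delta|\le\epsilon_M$; multiplication by $2$ is exact; there is no overflow or underflow. Thus the computed quantities are any real numbers with $\tilde T_0=1$, $\tilde T_1=x$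 and, for $n=2,\ldots,N$, $$\tilde T_n = \bigl(2x\,\tilde T_{n-1}(1+\alpha_n)-\tilde T_{n-2}\bigr)(1+\beta_n),\qquad |\alpha_n|,|\beta_n|\le\epsilon_M,$$ and the output is $\tilde T_N(x)=\tilde T_N$. $O(\epsilon_M^2)$ means: there exist $K,\epsilon_0>0$, depending only on $N$, such that for all $0<\epsilon_M\le\epsilon_0$, all admissible $x$ and all admissible rounding errors the term is bounded in absolute value by $K\epsilon_M^2$. *)

theory Defs
  imports Complex_Main "HOL-Computational_Algebra.Polynomial"
begin

fun cheb_T :: "nat \<Rightarrow> real poly" where
  "cheb_T 0 = 1"
| "cheb_T (Suc 0) = [:0, 1:]"
| "cheb_T (Suc (Suc n)) = [:0, 2:] * cheb_T (Suc n) - cheb_T n"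

definition cheb_C :: "nat \<Rightarrow> real \<Rightarrow> real" where
  "cheb_C N x = \<bar>poly (cheb_T N) x\<bar> + \<bar>x * poly (pderiv (cheb_T N)) x\<bar>"

text \<open>
  Floating point arithmetic is nondeterministic: an algorithm with real input maps a machine
  precision and an input to the set of all outputs that some admissible choice of rounding
  errors can produce.
\<close>

type_synonym fp_algorithm = "real \<Rightarrow> real \<Rightarrow> real set"

text \<open>
  \<open>t\<close> is a possible sequence of computed values of the three-term recursion at the exactly
  representable point \<open>x\<close>; only its entries up to \<open>N\<close> are constrained. The factor \<open>1 + \<alpha>\<close> comes
  from multiplying by \<open>x\<close> (doubling is exact), the factor \<open>1 + \<beta>\<close> from the subtraction.
\<close>

definition three_term_run :: "nat \<Rightarrow> real \<Rightarrow> real \<Rightarrow> (nat \<Rightarrow> real) \<Rightarrow> bool" where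
  "three_term_run N \<epsilon> x t \<longleftrightarrow>
     t 0 = 1 \<and> t 1 = x \<and>
     (\<forall>n\<in>{2..N}. \<exists>\<alpha> \<beta>. \<bar>\<alpha>\<bar> \<le> \<epsilon> \<and> \<bar>\<beta>\<bar> \<le> \<epsilon> \<and>
        t n = (2 * x * t (n - 1) * (1 + \<alpha>) - t (n - 2)) * (1 + \<beta>))"

definition three_term_alg :: "nat \<Rightarrow> fp_algorithm" where
  "three_term_alg N \<epsilon> x = {t N | t. three_term_run N \<epsilon> x t}"

text \<open>
  The constants \<open>K\<close> and \<open>\<epsilon>0\<close> hidden in the remainder \<open>O(\<epsilon>\<^sup>2)\<close> are uniform in the point and in
  the rounding errors.
\<close>

definition cheb_backward_stable :: "nat \<Rightarrow> fp_algorithm \<Rightarrow> real set \<Rightarrow> real \<Rightarrow> bool" where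
  "cheb_backward_stable N A S L \<longleftrightarrow>
     (\<exists>K>0. \<exists>\<epsilon>0>0. \<forall>\<epsilon>. 0 < \<epsilon> \<and> \<epsilon> \<le> \<epsilon>0 \<longrightarrow>
        (\<forall>x\<in>S. \<forall>y\<in>A \<epsilon> x.
           \<bar>y - poly (cheb_T N) x\<bar> \<le> \<epsilon> * L * cheb_C N x + K * \<epsilon>\<^sup>2))"

end

theory Submission
  imports Defs
begin

text \<open>
  The error \<open>e n\<close> of the computed values satisfies the Chebyshev recursion with a local defect
  \<open>r n\<close>, hence \<open>e N = (\<Sum>j=2..N. U (N - j) * r j)\<close> with the polynomials \<open>U\<close> of the second kind,
  and \<open>\<bar>r j\<bar> \<le> \<epsilon> (\<bar>T j\<bar> + 2 \<bar>x\<bar> \<bar>T (j - 1)\<bar>) + O(\<epsilon>\<^sup>2)\<close>. Since \<open>T' N = N U (N - 1)\<close> and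
  \<open>(T N)\<^sup>2 + (1 - x\<^sup>2) (U (N - 1))\<^sup>2 = 1\<close>, the condition number is at least \<open>1/2\<close> as soon as
  \<open>N\<^sup>2 x\<^sup>2 \<ge> 1/2\<close>, and \<open>\<bar>U k\<bar> \<le> k + 1\<close> gives the order \<open>N\<^sup>2\<close>. Near the origin \<open>U\<close> is bounded, which saves
  a factor \<open>N\<close>; there the condition number of an odd \<open>N\<close> is only of size \<open>N \<bar>x\<bar>\<close>, but
  then one of \<open>N - j\<close> and \<open>j\<close> is odd, so that every product \<open>U (N - j) T j\<close> is \<open>O(N \<bar>x\<bar>)\<close> as well.
\<close>

section \<open>Polynomials of the second kind: addition theorems, derivative and Pell
  identity\<close>

fun cheb_U :: "nat \<Rightarrow> real \<Rightarrow> real" where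
  "cheb_U 0 x = 1"
| "cheb_U (Suc 0) x = 2 * x"
| "cheb_U (Suc (Suc n)) x = 2 * x * cheb_U (Suc n) x - cheb_U n x"

lemma poly_cheb_T_Suc_Suc:
  "poly (cheb_T (Suc (Suc n))) x = 2 * x * poly (cheb_T (Suc n)) x - poly (cheb_T n) x"
  by simp

text \<open>For \<open>x = cos \<theta>\<close>, \<open>cheb_U n x\<close> is
  \<open>sin ((n + 1) \<theta>) / sin \<theta>\<close>; this is the addition theorem for
  \<open>sin ((n + 1) \<theta> + \<theta>)\<close>, divided by \<open>sin \<theta>\<close>.\<close>

lemma cheb_U_Suc: "cheb_U (Suc n) x = x * cheb_U n x + poly (cheb_T (Suc n)) x"
proof (induction n x rule: cheb_U.induct)
  case (3 n x)
  have "cheb_U (Suc (Suc (Suc n))) x = 2 * x * cheb_U (Suc (Suc n)) x - cheb_U (Suc n) x"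
    by (rule cheb_U.simps)
  also have "\<dots> = 2 * x * (x * cheb_U (Suc n) x + poly (cheb_T (Suc (Suc n))) x)
      - (x * cheb_U n x + poly (cheb_T (Suc n)) x)"
    by (simp only: 3)
  also have "\<dots> = x * cheb_U (Suc (Suc n)) x + poly (cheb_T (Suc (Suc (Suc n)))) x"
    unfolding poly_cheb_T_Suc_Suc[of "Suc n"] cheb_U.simps by (simp add: algebra_simps)
  finally show ?case .
qed (simp_all add: algebra_simps power2_eq_square)

text \<open>The addition theorem for \<open>cos ((n + 1) \<theta> + \<theta>)\<close>, where
  \<open>1 - x\<^sup>2\<close> stands for the squared sine.\<close>

lemma cheb_T_Suc_Suc:
  "poly (cheb_T (Suc (Suc n))) x = x * poly (cheb_T (Suc n)) x - (1 - x\<^sup>2) * cheb_U n x"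
proof (induction n x rule: cheb_U.induct)
  case (3 n x)
  have "poly (cheb_T (Suc (Suc (Suc (Suc n))))) x
      = 2 * x * poly (cheb_T (Suc (Suc (Suc n)))) x - poly (cheb_T (Suc (Suc n))) x"
    by (rule poly_cheb_T_Suc_Suc)
  also have "\<dots> = 2 * x * (x * poly (cheb_T (Suc (Suc n))) x - (1 - x\<^sup>2) * cheb_U (Suc n) x)
      - (x * poly (cheb_T (Suc n)) x - (1 - x\<^sup>2) * cheb_U n x)"
    by (simp only: 3)
  also have "\<dots> = x * poly (cheb_T (Suc (Suc (Suc n)))) x - (1 - x\<^sup>2) * cheb_U (Suc (Suc n)) x"
    unfolding poly_cheb_T_Suc_Suc[of "Suc n"] cheb_U.simps by (simp add: algebra_simps)
  finally show ?case .
qed (simp_all add: algebra_simps power2_eq_square)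

lemma pderiv_cheb_T_Suc:
  "poly (pderiv (cheb_T (Suc n))) x = (real n + 1) * cheb_U n x"
proof (induction n x rule: cheb_U.induct)
  case (3 n x)
  have "poly (pderiv (cheb_T (Suc (Suc (Suc n))))) x = 2 * poly (cheb_T (Suc (Suc n))) x
      + 2 * x * poly (pderiv (cheb_T (Suc (Suc n)))) x - poly (pderiv (cheb_T (Suc n))) x"
    unfolding cheb_T.simps(3)[of "Suc n"]
    by (simp add: pderiv_diff pderiv_mult pderiv_pCons pderiv_smult algebra_simps del: cheb_T.simps)
  also have "\<dots> = 2 * poly (cheb_T (Suc (Suc n))) x
      + 2 * x * ((real (Suc n) + 1) * cheb_U (Suc n) x) - (real n + 1) * cheb_U n x"
    by (simp only: 3)
  \<comment> \<open>The term that comes from differentiating the factor \<open>2 * x\<close> is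
    expressed by \<open>cheb_U\<close>; then everything is \<open>n + 3\<close> times the recursion
    for \<open>cheb_U (Suc (Suc n)) x\<close>.\<close>
  also have "poly (cheb_T (Suc (Suc n))) x = x * cheb_U (Suc n) x - cheb_U n x"
    using cheb_U_Suc[of "Suc n" x] by simp
  finally show ?case
    by (simp add: algebra_simps)
qed (simp_all add: pderiv_diff pderiv_mult pderiv_pCons pderiv_1)

lemma cheb_C_Suc:
  "cheb_C (Suc n) x = \<bar>poly (cheb_T (Suc n)) x\<bar> + real (Suc n) * \<bar>x\<bar> * \<bar>cheb_U n x\<bar>"
  by (simp add: cheb_C_def pderiv_cheb_T_Suc abs_mult del: cheb_T.simps)

text \<open>This is \<open>cos\<^sup>2 + sin\<^sup>2 = 1\<close>. The two addition theorems preserve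
  the quadratic form: the mixed terms cancel.\<close>

lemma cheb_pell: "(poly (cheb_T (Suc n)) x)\<^sup>2 + (1 - x\<^sup>2) * (cheb_U n x)\<^sup>2 = 1"
proof (induction n)
  case (Suc n)
  have "(poly (cheb_T (Suc (Suc n))) x)\<^sup>2 + (1 - x\<^sup>2) * (cheb_U (Suc n) x)\<^sup>2
      = (poly (cheb_T (Suc n)) x)\<^sup>2 + (1 - x\<^sup>2) * (cheb_U n x)\<^sup>2"
    unfolding cheb_T_Suc_Suc cheb_U_Suc by (simp add: power2_eq_square algebra_simps)
  with Suc show ?case by simp
qed simp

section \<open>Upper bounds on [-1, 1], and smaller ones near the origin by parity\<close>

lemma abs_cheb_T_le_1:
  assumes "\<bar>x\<bar> \<le> 1"
  shows "\<bar>poly (cheb_T n) x\<bar> \<le> 1"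
proof (cases n)
  case (Suc m)
  have "0 \<le> (1 - x\<^sup>2) * (cheb_U m x)\<^sup>2"
    using assms by (simp add: abs_square_le_1)
  then have "(poly (cheb_T n) x)\<^sup>2 \<le> 1"
    using cheb_pell[of m x] unfolding Suc by linarith
  then show ?thesis by (simp add: abs_square_le_1)
qed simp

lemma abs_cheb_U_le:
  assumes "\<bar>x\<bar> \<le> 1"
  shows "\<bar>cheb_U n x\<bar> \<le> real n + 1"
proof (induction n)
  case (Suc n)
  have "\<bar>x * cheb_U n x\<bar> \<le> 1 * (real n + 1)"
    unfolding abs_mult using assms Suc by (intro mult_mono) auto
  then show ?case
    unfolding cheb_U_Suc using abs_cheb_T_le_1[OF assms, of "Suc n"] by simp
qed simp

text \<open>The weighted quantity is the modulus of a sine. Unlike \<open>abs_cheb_U_le\<close> this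
  is uniform in \<open>n\<close>, so \<open>cheb_U\<close> stays bounded away from the
  endpoints.\<close>

lemma sqrt_mult_abs_cheb_U_le_1:
  assumes "\<bar>x\<bar> \<le> 1"
  shows "sqrt (1 - x\<^sup>2) * \<bar>cheb_U n x\<bar> \<le> 1"
proof -
  have "(sqrt (1 - x\<^sup>2) * \<bar>cheb_U n x\<bar>)\<^sup>2 = (1 - x\<^sup>2) * (cheb_U n x)\<^sup>2"
    using assms by (simp add: power_mult_distrib abs_square_le_1)
  also have "\<dots> \<le> 1"
    using cheb_pell[of n x] by (smt (verit) zero_le_power2)
  finally show ?thesis
    by (simp add: power_le_one_iff abs_square_le_1)
qed

text \<open>Both polynomials of odd degree vanish at 0. The two claims need a joint induction, since
  the addition theorems pass from one to the other; each step adds at most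
  \<open>\<bar>x\<bar>\<close>.\<close>

lemma cheb_parity_bounds:
  assumes "\<bar>x\<bar> \<le> 1"
  shows "(even n \<longrightarrow> \<bar>poly (cheb_T (Suc n)) x\<bar> \<le> (real n + 1) * \<bar>x\<bar>) \<and>
    (odd n \<longrightarrow> sqrt (1 - x\<^sup>2) * \<bar>cheb_U n x\<bar> \<le> (real n + 1) * \<bar>x\<bar>)"
proof (induction n)
  case (Suc n)
  define c where "c = sqrt (1 - x\<^sup>2)"
  have c: "0 \<le> c" "c \<le> 1" "c * c = 1 - x\<^sup>2"
    using assms by (simp_all add: c_def abs_square_le_1)
  have x_T: "\<bar>x * poly (cheb_T (Suc n)) x\<bar> \<le> \<bar>x\<bar>"
    using mult_left_mono[OF abs_cheb_T_le_1[OF assms, of "Suc n"], of "\<bar>x\<bar>"] by (simp add: abs_mult)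
  have x_U: "c * \<bar>x * cheb_U n x\<bar> \<le> \<bar>x\<bar>"
    using mult_left_mono[OF sqrt_mult_abs_cheb_U_le_1[OF assms, of n], of "\<bar>x\<bar>"]
    by (simp add: abs_mult c_def ac_simps)
  show ?case
  proof (cases "even n")
    case True
    have "c * \<bar>poly (cheb_T (Suc n)) x\<bar> \<le> \<bar>poly (cheb_T (Suc n)) x\<bar>"
      using c by (simp add: mult_left_le_one_le)
    moreover have "c * \<bar>cheb_U (Suc n) x\<bar>
        \<le> c * (\<bar>x * cheb_U n x\<bar> + \<bar>poly (cheb_T (Suc n)) x\<bar>)"
      unfolding cheb_U_Suc using c by (intro mult_left_mono abs_triangle_ineq)
    ultimately show ?thesis
      using True Suc x_U by (simp add: c_def algebra_simps del: cheb_T.simps)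
  next
    case False
    \<comment> \<open>One factor \<open>c\<close> is the weight in the induction hypothesis, the
      other is bounded by 1.\<close>
    have "\<bar>(1 - x\<^sup>2) * cheb_U n x\<bar> = c * (c * \<bar>cheb_U n x\<bar>)"
      using c by (simp add: abs_mult flip: c(3))
    also have "\<dots> \<le> c * \<bar>cheb_U n x\<bar>"
      using c by (intro mult_left_le_one_le) auto
    finally show ?thesis
      using False Suc x_T abs_triangle_ineq4[of "x * poly (cheb_T (Suc n)) x" "(1 - x\<^sup>2) * cheb_U n x"]
      unfolding cheb_T_Suc_Suc by (simp add: c_def algebra_simps del: cheb_T.simps)
  qed
qed simp

lemma abs_cheb_T_odd_le:
  assumes "\<bar>x\<bar> \<le> 1" "odd n"
  shows "\<bar>poly (cheb_T n) x\<bar> \<le> real n * \<bar>x\<bar>"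
  using cheb_parity_bounds[OF assms(1), of "n - 1"] assms(2)
  by (cases n) (auto simp: add.commute simp del: cheb_T.simps)

section \<open>Lower bounds for the condition number\<close>

lemma one_le_abs_add_abs:
  fixes a b :: real
  assumes "a\<^sup>2 + b\<^sup>2 = 1"
  shows "1 \<le> \<bar>a\<bar> + \<bar>b\<bar>"
proof (rule power2_le_imp_le)
  have "0 \<le> \<bar>a\<bar> * \<bar>b\<bar>" by simp
  then show "1\<^sup>2 \<le> (\<bar>a\<bar> + \<bar>b\<bar>)\<^sup>2" using assms by (simp add: power2_sum)
qed simp

text \<open>The root of 1/2 is rounded down to 1/2 to keep the later constants rational.\<close>

lemma half_le_abs:
  fixes a :: real
  assumes "1 / 2 \<le> a\<^sup>2"
  shows "1 / 2 \<le> \<bar>a\<bar>"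
  by (rule power2_le_imp_le) (use assms in \<open>simp_all add: power2_eq_square\<close>)

text \<open>Here \<open>n * \<bar>x\<bar>\<close> is at least 1/2, so the derivative part is at
  least half of \<open>c * \<bar>cheb_U m x\<bar>\<close>; by the Pell identity that quantity and
  \<open>\<bar>T n\<bar>\<close> add up to at least 1.\<close>

lemma cheb_C_ge_half:
  assumes "\<bar>x\<bar> \<le> 1" "n \<ge> 1" and large: "1 / 2 \<le> (real n)\<^sup>2 * x\<^sup>2"
  shows "1 / 2 \<le> cheb_C n x"
proof -
  obtain m where n: "n = Suc m" using assms(2) by (cases n) auto
  define c where "c = sqrt (1 - x\<^sup>2)"
  have c: "0 \<le> c" "c \<le> 1" "c\<^sup>2 = 1 - x\<^sup>2"
    using assms by (simp_all add: c_def abs_square_le_1)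
  have "1 / 2 \<le> real n * \<bar>x\<bar>"
    using half_le_abs[of "real n * x"] large by (simp add: power_mult_distrib abs_mult)
  moreover have "c * \<bar>cheb_U m x\<bar> \<le> \<bar>cheb_U m x\<bar>"
    using c by (intro mult_left_le_one_le) auto
  ultimately have "1 / 2 * (c * \<bar>cheb_U m x\<bar>) \<le> real n * \<bar>x\<bar> * \<bar>cheb_U m x\<bar>"
    using c by (intro mult_mono) auto
  moreover have "1 \<le> \<bar>poly (cheb_T n) x\<bar> + c * \<bar>cheb_U m x\<bar>"
    using one_le_abs_add_abs[of "poly (cheb_T n) x" "c * cheb_U m x"] cheb_pell[of m x] c
    by (simp add: n power_mult_distrib abs_mult del: cheb_T.simps)
  ultimately show ?thesis
    unfolding n cheb_C_Suc by linarith
qed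

text \<open>Near 0 the polynomial \<open>cheb_U\<close> of odd index \<open>n - 1\<close> is small,
  so the Pell identity forces \<open>T n\<close> to be large.\<close>

lemma cheb_C_ge_half_even:
  assumes "\<bar>x\<bar> \<le> 1" "n \<ge> 1" "even n"
  shows "1 / 2 \<le> cheb_C n x"
proof (cases "1 / 2 \<le> (real n)\<^sup>2 * x\<^sup>2")
  case False
  obtain m where n: "n = Suc m" using assms(2) by (cases n) auto
  have "sqrt (1 - x\<^sup>2) * \<bar>cheb_U m x\<bar> \<le> real n * \<bar>x\<bar>"
    using cheb_parity_bounds[OF assms(1), of m] assms(3) n by (simp add: add.commute)
  then have "(sqrt (1 - x\<^sup>2) * \<bar>cheb_U m x\<bar>)\<^sup>2 \<le> (real n * \<bar>x\<bar>)\<^sup>2"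
    using assms(1) by (intro power_mono) (auto simp: abs_square_le_1)
  then have "(1 - x\<^sup>2) * (cheb_U m x)\<^sup>2 \<le> (real n)\<^sup>2 * x\<^sup>2"
    using assms(1) by (simp add: power_mult_distrib abs_square_le_1)
  then have "1 / 2 \<le> (poly (cheb_T n) x)\<^sup>2"
    using False cheb_pell[of m x] unfolding n by linarith
  then show ?thesis
    using half_le_abs unfolding cheb_C_def by (meson abs_ge_zero add_increasing2)
qed (use assms cheb_C_ge_half in blast)

text \<open>The roles are exchanged: near 0 it is \<open>T n\<close> that is small, so
  \<open>cheb_U\<close> of index \<open>n - 1\<close> is large, and the derivative part supplies the
  factor \<open>n * \<bar>x\<bar>\<close>.\<close>

lemma cheb_C_ge_odd:
  assumes "\<bar>x\<bar> \<le> 1" "odd n" and small: "real n * \<bar>x\<bar> \<le> 1"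
  shows "1 / 2 * (real n * \<bar>x\<bar>) \<le> cheb_C n x"
proof (cases "1 / 2 \<le> (real n)\<^sup>2 * x\<^sup>2")
  case True
  have "n \<ge> 1" using assms(2) by (cases n) auto
  then show ?thesis using cheb_C_ge_half[OF assms(1) _ True] small by simp
next
  case False
  obtain m where n: "n = Suc m" using assms(2) by (cases n) auto
  have "\<bar>poly (cheb_T n) x\<bar>\<^sup>2 \<le> (real n * \<bar>x\<bar>)\<^sup>2"
    using abs_cheb_T_odd_le[OF assms(1,2)] by (intro power_mono) auto
  moreover have "(1 - x\<^sup>2) * (cheb_U m x)\<^sup>2 \<le> (cheb_U m x)\<^sup>2"
    using assms(1) by (intro mult_left_le_one_le) (auto simp: abs_square_le_1)
  ultimately have "1 / 2 \<le> (cheb_U m x)\<^sup>2"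
    using False cheb_pell[of m x] n by (simp add: power_mult_distrib del: cheb_T.simps)
  then have "real n * \<bar>x\<bar> * (1 / 2) \<le> real n * \<bar>x\<bar> * \<bar>cheb_U m x\<bar>"
    using half_le_abs by (intro mult_left_mono) auto
  then show ?thesis
    unfolding n cheb_C_Suc by linarith
qed

section \<open>Propagation of local defects through the recursion\<close>

text \<open>Discrete variation of constants: \<open>cheb_U (n - j) x\<close> is the response at
  \<open>n\<close> to a unit defect at \<open>j\<close>.\<close>

lemma cheb_recurrence_solution:
  fixes d :: "nat \<Rightarrow> real"
  assumes "d 0 = 0" "d 1 = 0"
  shows "d n = (\<Sum>j=2..n. cheb_U (n - j) x * (d j - 2 * x * d (j - 1) + d (j - 2)))"
proof (induction n rule: induct_nat_012)
  case (ge2 n)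
  define r where "r j = d j - 2 * x * d (j - 1) + d (j - 2)" for j
  have "(\<Sum>j=2..Suc (Suc n). cheb_U (Suc (Suc n) - j) x * r j)
      = (\<Sum>j=2..Suc n. cheb_U (Suc (Suc n) - j) x * r j) + r (Suc (Suc n))"
    by simp
  also have "(\<Sum>j=2..Suc n. cheb_U (Suc (Suc n) - j) x * r j)
      = (\<Sum>j=2..Suc n. 2 * x * (cheb_U (Suc n - j) x * r j)
          - (if j \<le> n then cheb_U (n - j) x * r j else 0))"
  proof (rule sum.cong[OF refl])
    fix j assume j: "j \<in> {2..Suc n}"
    show "cheb_U (Suc (Suc n) - j) x * r j = 2 * x * (cheb_U (Suc n - j) x * r j)
          - (if j \<le> n then cheb_U (n - j) x * r j else 0)"
    proof (cases "j \<le> n")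
      case True
      then show ?thesis by (simp add: Suc_diff_le algebra_simps)
    next
      case False
      then have "j = Suc n" using j by simp
      then show ?thesis by simp
    qed
  qed
  also have "\<dots> = 2 * x * (\<Sum>j=2..Suc n. cheb_U (Suc n - j) x * r j)
      - (\<Sum>j=2..n. cheb_U (n - j) x * r j)"
    unfolding sum_subtractf sum_distrib_left
    by (cases n) (auto intro!: sum.cong)
  also have "\<dots> = 2 * x * d (Suc n) - d n"
    using ge2 by (simp only: r_def)
  finally show ?case
    by (simp add: r_def)
qed (use assms in simp_all)

section \<open>Rounding errors of a single run\<close>

lemma rounding_defect:
  fixes x p q \<alpha> \<beta> \<epsilon> :: real
  assumes "\<bar>x\<bar> \<le> 1" "\<bar>\<alpha>\<bar> \<le> \<epsilon>" "\<bar>\<beta>\<bar> \<le> \<epsilon>"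
  shows "\<bar>(2 * x * p * (1 + \<alpha>) - q) * (1 + \<beta>) - (2 * x * p - q)\<bar>
    \<le> \<epsilon> * (2 * \<bar>x\<bar> * \<bar>p\<bar> + \<bar>2 * x * p - q\<bar>) + \<epsilon>\<^sup>2 * (2 * \<bar>p\<bar>)"
proof -
  have "\<epsilon> \<ge> 0" using assms(2) by linarith
  have "\<bar>\<alpha> * (2 * x * p)\<bar> \<le> \<epsilon> * (2 * \<bar>x\<bar> * \<bar>p\<bar>)"
    unfolding abs_mult using assms by (intro mult_mono) auto
  moreover have "\<bar>\<beta> * (2 * x * p - q)\<bar> \<le> \<epsilon> * \<bar>2 * x * p - q\<bar>"
    unfolding abs_mult using assms by (intro mult_mono) auto
  moreover have "\<bar>(\<alpha> * \<beta>) * (2 * (x * p))\<bar> \<le> \<epsilon>\<^sup>2 * (2 * (1 * \<bar>p\<bar>))"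
    unfolding abs_mult power2_eq_square using assms \<open>\<epsilon> \<ge> 0\<close> by (intro mult_mono) auto
  moreover have "(2 * x * p * (1 + \<alpha>) - q) * (1 + \<beta>) - (2 * x * p - q)
      = \<alpha> * (2 * x * p) + \<beta> * (2 * x * p - q) + (\<alpha> * \<beta>) * (2 * (x * p))"
    by (simp add: algebra_simps)
  ultimately show ?thesis unfolding distrib_left[of \<epsilon>] by linarith
qed

lemma abs_mult_le_right:
  fixes x p :: real
  assumes "\<bar>x\<bar> \<le> 1"
  shows "\<bar>x * p\<bar> \<le> \<bar>p\<bar>"
  using assms by (simp add: abs_mult mult_left_le_one_le)

context
  fixes N :: nat and \<epsilon> x :: real and t :: "nat \<Rightarrow> real"
  assumes run: "three_term_run N \<epsilon> x t"
    and x: "\<bar>x\<bar> \<le> 1" and eps: "0 < \<epsilon>" "\<epsilon> \<le> 1"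
begin

lemma three_term_run_step:
  assumes "Suc (Suc n) \<le> N"
  shows "\<bar>t (Suc (Suc n)) - (2 * x * t (Suc n) - t n)\<bar>
    \<le> \<epsilon> * (2 * \<bar>x\<bar> * \<bar>t (Suc n)\<bar> + \<bar>2 * x * t (Suc n) - t n\<bar>) + \<epsilon>\<^sup>2 * (2 * \<bar>t (Suc n)\<bar>)"
proof -
  have "\<forall>k\<in>{2..N}. \<exists>\<alpha> \<beta>. \<bar>\<alpha>\<bar> \<le> \<epsilon> \<and> \<bar>\<beta>\<bar> \<le> \<epsilon> \<and>
      t k = (2 * x * t (k - 1) * (1 + \<alpha>) - t (k - 2)) * (1 + \<beta>)"
    using run unfolding three_term_run_def by blast
  from bspec[OF this, of "Suc (Suc n)"] assms
  have "\<exists>\<alpha> \<beta>. \<bar>\<alpha>\<bar> \<le> \<epsilon> \<and> \<bar>\<beta>\<bar> \<le> \<epsilon> \<and>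
      t (Suc (Suc n)) = (2 * x * t (Suc n) * (1 + \<alpha>) - t n) * (1 + \<beta>)"
    by simp
  then show ?thesis using rounding_defect x by metis
qed

text \<open>A bound uniform in \<open>x\<close> and in the rounding errors. Base 10 works because
  \<open>8 * 10 + 2\<close> is at most 100; it enters only the second-order constant.\<close>

lemma three_term_run_growth: "n \<le> N \<Longrightarrow> \<bar>t n\<bar> \<le> 10 ^ n"
proof (induction n rule: induct_nat_012)
  case (ge2 n)
  have IH: "\<bar>t n\<bar> \<le> 10 ^ n" "\<bar>t (Suc n)\<bar> \<le> 10 * 10 ^ n"
    using ge2 by auto
  have "\<bar>x * t (Suc n)\<bar> \<le> \<bar>t (Suc n)\<bar>"
    by (rule abs_mult_le_right[OF x])
  then have xt: "2 * \<bar>x\<bar> * \<bar>t (Suc n)\<bar> \<le> 2 * \<bar>t (Suc n)\<bar>"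
      "\<bar>2 * x * t (Suc n) - t n\<bar> \<le> 2 * \<bar>t (Suc n)\<bar> + \<bar>t n\<bar>"
    by (simp add: abs_mult, linarith)
  note three_term_run_step[OF ge2.prems]
  also have "\<epsilon> * (2 * \<bar>x\<bar> * \<bar>t (Suc n)\<bar> + \<bar>2 * x * t (Suc n) - t n\<bar>) + \<epsilon>\<^sup>2 * (2 * \<bar>t (Suc n)\<bar>)
      \<le> 1 * (2 * \<bar>x\<bar> * \<bar>t (Suc n)\<bar> + \<bar>2 * x * t (Suc n) - t n\<bar>) + 1 * (2 * \<bar>t (Suc n)\<bar>)"
    using eps by (intro add_mono mult_right_mono) (auto simp: power_le_one)
  also have "\<dots> \<le> 6 * \<bar>t (Suc n)\<bar> + \<bar>t n\<bar>"
    using add_mono[OF xt] by simp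
  finally have "\<bar>t (Suc (Suc n))\<bar> \<le> 8 * \<bar>t (Suc n)\<bar> + 2 * \<bar>t n\<bar>"
    using xt(2) by linarith
  also have "\<dots> \<le> 10 ^ Suc (Suc n)"
    using IH by simp
  finally show ?case .
qed (use run x in \<open>auto simp: three_term_run_def\<close>)

text \<open>The exponential constant is harmless: the bound serves only to replace computed values
  by exact ones in the defect, where it is multiplied by another \<open>\<epsilon>\<close>.\<close>

lemma three_term_run_error_crude:
  "n \<le> N \<Longrightarrow> \<bar>t n - poly (cheb_T n) x\<bar> \<le> \<epsilon> * 10 ^ n"
proof (induction n rule: induct_nat_012)
  case (ge2 n)
  let ?d = "\<lambda>n. t n - poly (cheb_T n) x"
  have IH: "\<bar>?d n\<bar> \<le> \<epsilon> * 10 ^ n" "\<bar>?d (Suc n)\<bar> \<le> 10 * (\<epsilon> * 10 ^ n)"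
    using ge2 by (auto simp del: cheb_T.simps)
  have t: "\<bar>t n\<bar> \<le> 10 ^ n" "\<bar>t (Suc n)\<bar> \<le> 10 * 10 ^ n"
    using three_term_run_growth[of n] three_term_run_growth[of "Suc n"] ge2.prems by auto
  have xt: "\<bar>x * t (Suc n)\<bar> \<le> \<bar>t (Suc n)\<bar>" and xd: "\<bar>x * ?d (Suc n)\<bar> \<le> \<bar>?d (Suc n)\<bar>"
    by (rule abs_mult_le_right[OF x])+
  have "\<epsilon> * (2 * \<bar>x\<bar> * \<bar>t (Suc n)\<bar> + \<bar>2 * x * t (Suc n) - t n\<bar>) \<le> \<epsilon> * (41 * 10 ^ n)"
    using xt t eps by (intro mult_left_mono) (simp_all add: abs_mult)
  \<comment> \<open>The square is lowered to \<open>\<epsilon>\<close> by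
    \<open>\<epsilon> \<le> 1\<close>. In all \<open>41 + 20 + 20 + 1\<close> is at most
    100.\<close>
  moreover have "\<epsilon>\<^sup>2 * (2 * \<bar>t (Suc n)\<bar>) \<le> \<epsilon> * (20 * 10 ^ n)"
    by (rule mult_mono) (use t eps in \<open>auto simp: power2_eq_square mult_left_le\<close>)
  ultimately have "\<bar>t (Suc (Suc n)) - (2 * x * t (Suc n) - t n)\<bar>
      \<le> \<epsilon> * (41 * 10 ^ n) + \<epsilon> * (20 * 10 ^ n)"
    by (rule order_trans[OF three_term_run_step[OF ge2.prems] add_mono])
  moreover have "?d (Suc (Suc n)) = (t (Suc (Suc n)) - (2 * x * t (Suc n) - t n))
      + 2 * (x * ?d (Suc n)) - ?d n"
    unfolding poly_cheb_T_Suc_Suc by (simp add: algebra_simps del: cheb_T.simps)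
  ultimately have "\<bar>?d (Suc (Suc n))\<bar> \<le> 100 * (\<epsilon> * 10 ^ n)"
    using xd IH by linarith
  then show ?case by (simp del: cheb_T.simps)
qed (use run x eps in \<open>auto simp: three_term_run_def\<close>)

lemma three_term_run_defect:
  assumes "Suc (Suc n) \<le> N"
  shows "\<bar>t (Suc (Suc n)) - (2 * x * t (Suc n) - t n)\<bar>
    \<le> \<epsilon> * (\<bar>poly (cheb_T (Suc (Suc n))) x\<bar> + 2 * \<bar>x\<bar> * \<bar>poly (cheb_T (Suc n)) x\<bar>)
      + \<epsilon>\<^sup>2 * 10 ^ Suc (Suc n)"
proof -
  let ?T = "\<lambda>n. poly (cheb_T n) x"
  let ?d = "\<lambda>n. t n - ?T n"
  have d: "\<bar>?d n\<bar> \<le> \<epsilon> * 10 ^ n" "\<bar>?d (Suc n)\<bar> \<le> 10 * (\<epsilon> * 10 ^ n)"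
    using three_term_run_error_crude[of n] three_term_run_error_crude[of "Suc n"] assms
    by (auto simp del: cheb_T.simps)
  have xd: "\<bar>x * ?d (Suc n)\<bar> \<le> \<bar>?d (Suc n)\<bar>"
    by (rule abs_mult_le_right[OF x])
  have "x * t (Suc n) = x * ?T (Suc n) + x * ?d (Suc n)"
    by (simp add: algebra_simps)
  then have "\<bar>x * t (Suc n)\<bar> \<le> \<bar>x * ?T (Suc n)\<bar> + 10 * (\<epsilon> * 10 ^ n)"
    using xd d by linarith
  moreover have "2 * x * t (Suc n) - t n = ?T (Suc (Suc n)) + 2 * (x * ?d (Suc n)) - ?d n"
    unfolding poly_cheb_T_Suc_Suc by (simp add: algebra_simps del: cheb_T.simps)
  then have "\<bar>2 * x * t (Suc n) - t n\<bar> \<le> \<bar>?T (Suc (Suc n))\<bar> + 21 * (\<epsilon> * 10 ^ n)"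
    using xd d by linarith
  \<comment> \<open>The 41 is twice 10 from the product plus 21 from the difference.\<close>
  ultimately have "2 * \<bar>x\<bar> * \<bar>t (Suc n)\<bar> + \<bar>2 * x * t (Suc n) - t n\<bar>
      \<le> \<bar>?T (Suc (Suc n))\<bar> + 2 * \<bar>x\<bar> * \<bar>?T (Suc n)\<bar> + 41 * (\<epsilon> * 10 ^ n)"
    by (simp add: abs_mult del: cheb_T.simps)
  then have "\<epsilon> * (2 * \<bar>x\<bar> * \<bar>t (Suc n)\<bar> + \<bar>2 * x * t (Suc n) - t n\<bar>)
      \<le> \<epsilon> * (\<bar>?T (Suc (Suc n))\<bar> + 2 * \<bar>x\<bar> * \<bar>?T (Suc n)\<bar> + 41 * (\<epsilon> * 10 ^ n))"
    using eps by (intro mult_left_mono) auto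
  also have "\<dots> = \<epsilon> * (\<bar>?T (Suc (Suc n))\<bar> + 2 * \<bar>x\<bar> * \<bar>?T (Suc n)\<bar>) + 41 * (\<epsilon>\<^sup>2 * 10 ^ n)"
    by (simp add: algebra_simps power2_eq_square del: cheb_T.simps)
  finally have "\<epsilon> * (2 * \<bar>x\<bar> * \<bar>t (Suc n)\<bar> + \<bar>2 * x * t (Suc n) - t n\<bar>)
      \<le> \<epsilon> * (\<bar>?T (Suc (Suc n))\<bar> + 2 * \<bar>x\<bar> * \<bar>?T (Suc n)\<bar>) + 41 * (\<epsilon>\<^sup>2 * 10 ^ n)" .
  moreover have "\<epsilon>\<^sup>2 * (2 * \<bar>t (Suc n)\<bar>) \<le> \<epsilon>\<^sup>2 * (2 * (10 * 10 ^ n))"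
    using three_term_run_growth[of "Suc n"] assms by (intro mult_left_mono) auto
  moreover have "0 \<le> \<epsilon>\<^sup>2 * 10 ^ n" by simp
  ultimately show ?thesis
    using three_term_run_step[OF assms] unfolding power_Suc by linarith
qed

text \<open>Fewer than \<open>N\<close> defects are summed. \<open>M\<close> controls their
  first-order effect; for the second-order remainder the crude bound on \<open>cheb_U\<close>
  suffices.\<close>

lemma three_term_run_error:
  assumes M: "\<And>j. j \<in> {2..N} \<Longrightarrow> \<bar>cheb_U (N - j) x\<bar>
      * (\<bar>poly (cheb_T j) x\<bar> + 2 * \<bar>x\<bar> * \<bar>poly (cheb_T (j - 1)) x\<bar>) \<le> M"
    and "M \<ge> 0"
  shows "\<bar>t N - poly (cheb_T N) x\<bar> \<le> \<epsilon> * (real N * M) + real N * (real N * 10 ^ N) * \<epsilon>\<^sup>2"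
proof -
  define d where "d n = t n - poly (cheb_T n) x" for n
  define r where "r j = d j - 2 * x * d (j - 1) + d (j - 2)" for j
  have "d N = (\<Sum>j=2..N. cheb_U (N - j) x * r j)"
    unfolding r_def using run by (intro cheb_recurrence_solution) (auto simp: d_def three_term_run_def)
  then have "\<bar>d N\<bar> \<le> (\<Sum>j=2..N. \<bar>cheb_U (N - j) x * r j\<bar>)"
    by (simp add: sum_abs)
  also have "\<dots> \<le> (\<Sum>j=2..N. \<epsilon> * M + \<epsilon>\<^sup>2 * (real N * 10 ^ N))"
  proof (rule sum_mono)
    fix j assume j: "j \<in> {2..N}"
    define n where "n = j - 2"
    have n: "j = Suc (Suc n)" using j unfolding n_def atLeastAtMost_iff by linarith
    let ?B = "\<bar>poly (cheb_T j) x\<bar> + 2 * \<bar>x\<bar> * \<bar>poly (cheb_T (j - 1)) x\<bar>"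
    have "r j = t (Suc (Suc n)) - (2 * x * t (Suc n) - t n)"
      unfolding r_def d_def n poly_cheb_T_Suc_Suc by (simp add: algebra_simps del: cheb_T.simps)
    then have "\<bar>r j\<bar> \<le> \<epsilon> * ?B + \<epsilon>\<^sup>2 * 10 ^ j"
      using three_term_run_defect[of n] j n by (simp del: cheb_T.simps)
    then have "\<bar>cheb_U (N - j) x * r j\<bar> \<le> \<bar>cheb_U (N - j) x\<bar> * (\<epsilon> * ?B + \<epsilon>\<^sup>2 * 10 ^ j)"
      unfolding abs_mult by (intro mult_left_mono) auto
    also have "\<dots> = \<epsilon> * (\<bar>cheb_U (N - j) x\<bar> * ?B) + \<epsilon>\<^sup>2 * (\<bar>cheb_U (N - j) x\<bar> * 10 ^ j)"
      by (simp add: algebra_simps del: cheb_T.simps)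
    also have "\<dots> \<le> \<epsilon> * M + \<epsilon>\<^sup>2 * (real N * 10 ^ N)"
    proof -
      have "\<bar>cheb_U (N - j) x\<bar> \<le> real N"
        using abs_cheb_U_le[OF x, of "N - j"] j by (simp add: of_nat_diff)
      then have "\<bar>cheb_U (N - j) x\<bar> * 10 ^ j \<le> real N * 10 ^ N"
        using j by (intro mult_mono power_increasing) auto
      then show ?thesis
        using M[OF j] eps by (intro add_mono mult_left_mono) auto
    qed
    finally show "\<bar>cheb_U (N - j) x * r j\<bar> \<le> \<epsilon> * M + \<epsilon>\<^sup>2 * (real N * 10 ^ N)" .
  qed
  also have "\<dots> = real (card {2..N}) * (\<epsilon> * M + \<epsilon>\<^sup>2 * (real N * 10 ^ N))"
    by (rule sum_constant)
  also have "\<dots> \<le> real N * (\<epsilon> * M + \<epsilon>\<^sup>2 * (real N * 10 ^ N))"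
    using eps \<open>M \<ge> 0\<close> by (intro mult_right_mono) auto
  finally show ?thesis
    by (simp add: d_def algebra_simps)
qed

end

section \<open>From termwise estimates to backward stability\<close>

text \<open>Reduces stability to one summand at a time, relative to the condition number; the factor
  \<open>real N\<close> pays for the number of summands.\<close>

lemma cheb_backward_stable_three_termI:
  assumes "N \<ge> 1" "L \<ge> 0" "S \<subseteq> {-1..1}"
    and bound: "\<And>x j. x \<in> S \<Longrightarrow> j \<in> {2..N} \<Longrightarrow> \<bar>cheb_U (N - j) x\<bar>
      * (\<bar>poly (cheb_T j) x\<bar> + 2 * \<bar>x\<bar> * \<bar>poly (cheb_T (j - 1)) x\<bar>) \<le> L * cheb_C N x"
  shows "cheb_backward_stable N (three_term_alg N) S (L * real N)"
  unfolding cheb_backward_stable_def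
proof (intro exI conjI allI impI ballI)
  show "0 < real N * (real N * 10 ^ N)" "0 < (1::real)" using assms(1) by auto
  fix \<epsilon> x y :: real
  assume eps: "0 < \<epsilon> \<and> \<epsilon> \<le> 1" and xS: "x \<in> S" and "y \<in> three_term_alg N \<epsilon> x"
  then obtain t where t: "three_term_run N \<epsilon> x t" "y = t N"
    by (auto simp: three_term_alg_def)
  have "\<bar>x\<bar> \<le> 1" using subsetD[OF assms(3) xS] by auto
  moreover have "0 \<le> L * cheb_C N x"
    using \<open>L \<ge> 0\<close> by (simp add: cheb_C_def)
  ultimately show "\<bar>y - poly (cheb_T N) x\<bar>
      \<le> \<epsilon> * (L * real N) * cheb_C N x + real N * (real N * 10 ^ N) * \<epsilon>\<^sup>2"
    using three_term_run_error[OF t(1) _ _ _ bound[OF xS]] eps t(2) by (simp add: ac_simps)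
qed

lemma abs_cheb_T_sum_le_3:
  assumes "\<bar>x\<bar> \<le> 1"
  shows "\<bar>poly (cheb_T j) x\<bar> + 2 * \<bar>x\<bar> * \<bar>poly (cheb_T k) x\<bar> \<le> 3"
  using abs_cheb_T_le_1[OF assms, of j] mult_mono[OF assms abs_cheb_T_le_1[OF assms, of k]]
  by simp

text \<open>Away from 0 the crude bounds \<open>N\<close> and 3 on the factors suffice, as the
  condition number is at least 1/2.\<close>

lemma error_term_le_large:
  assumes "\<bar>x\<bar> \<le> 1" "j \<in> {2..N}" and large: "1 / 2 \<le> (real N)\<^sup>2 * x\<^sup>2"
  shows "\<bar>cheb_U (N - j) x\<bar> * (\<bar>poly (cheb_T j) x\<bar> + 2 * \<bar>x\<bar> * \<bar>poly (cheb_T (j - 1)) x\<bar>)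
    \<le> 6 * real N * cheb_C N x"
proof -
  have "\<bar>cheb_U (N - j) x\<bar> \<le> real N"
    using abs_cheb_U_le[OF assms(1), of "N - j"] assms(2) by (simp add: of_nat_diff)
  then have "\<bar>cheb_U (N - j) x\<bar> * (\<bar>poly (cheb_T j) x\<bar> + 2 * \<bar>x\<bar> * \<bar>poly (cheb_T (j - 1)) x\<bar>)
      \<le> real N * 3"
    using abs_cheb_T_sum_le_3[OF assms(1)] by (intro mult_mono) auto
  also have "\<dots> = 6 * real N * (1 / 2)"
    by simp
  also have "\<dots> \<le> 6 * real N * cheb_C N x"
    using cheb_C_ge_half[OF assms(1) _ large] assms(2) by (intro mult_left_mono) auto
  finally show ?thesis .
qed

text \<open>No factor \<open>N\<close> is lost here: for even \<open>N\<close> the summand is at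
  most 6 and the condition number at least 1/2; for odd \<open>N\<close> both are compared with
  \<open>N * \<bar>x\<bar>\<close>.\<close>

lemma error_term_le_small:
  assumes "N \<ge> 2" "j \<in> {2..N}" and small: "real N * \<bar>x\<bar> \<le> 1"
  shows "\<bar>cheb_U (N - j) x\<bar> * (\<bar>poly (cheb_T j) x\<bar> + 2 * \<bar>x\<bar> * \<bar>poly (cheb_T (j - 1)) x\<bar>)
    \<le> 12 * cheb_C N x"
proof -
  \<comment> \<open>\<open>N \<ge> 2\<close> keeps \<open>x\<close> away from the endpoints, which
    makes \<open>cheb_U\<close> bounded by 2.\<close>
  have "2 * \<bar>x\<bar> \<le> real N * \<bar>x\<bar>"
    using assms(1) by (intro mult_right_mono) auto
  then have x_half: "\<bar>x\<bar> \<le> 1 / 2" using small by linarith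
  then have x: "\<bar>x\<bar> \<le> 1" by linarith
  have "x\<^sup>2 \<le> (1 / 2)\<^sup>2"
    using x_half power_mono[of "\<bar>x\<bar>" "1 / 2" 2] by simp
  then have "1 / 2 \<le> sqrt (1 - x\<^sup>2)"
    by (intro real_le_rsqrt) (simp add: power2_eq_square)
  then have U_scale: "1 / 2 * \<bar>cheb_U k x\<bar> \<le> sqrt (1 - x\<^sup>2) * \<bar>cheb_U k x\<bar>" for k
    by (intro mult_right_mono) auto
  have U_le_2: "\<bar>cheb_U k x\<bar> \<le> 2" for k
    using U_scale[of k] sqrt_mult_abs_cheb_U_le_1[OF x, of k] by linarith
  show ?thesis
  proof (cases "even N")
    case True
    have "\<bar>cheb_U (N - j) x\<bar> * (\<bar>poly (cheb_T j) x\<bar> + 2 * \<bar>x\<bar> * \<bar>poly (cheb_T (j - 1)) x\<bar>) \<le> 2 * 3"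
      using U_le_2 abs_cheb_T_sum_le_3[OF x] by (intro mult_mono) auto
    then show ?thesis
      using cheb_C_ge_half_even[OF x _ True] assms(1) by simp
  next
    case False
    have C: "1 / 2 * (real N * \<bar>x\<bar>) \<le> cheb_C N x"
      by (rule cheb_C_ge_odd[OF x False small])
    show ?thesis
    proof (cases "even j")
      case True
      have "sqrt (1 - x\<^sup>2) * \<bar>cheb_U (N - j) x\<bar> \<le> (real (N - j) + 1) * \<bar>x\<bar>"
        using cheb_parity_bounds[OF x, of "N - j"] False True assms(2) by auto
      also have "\<dots> \<le> real N * \<bar>x\<bar>"
        using assms(2) by (intro mult_right_mono) (auto simp: of_nat_diff)
      finally have "\<bar>cheb_U (N - j) x\<bar> \<le> 2 * (real N * \<bar>x\<bar>)"
        using U_scale[of "N - j"] by linarith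
      then have "\<bar>cheb_U (N - j) x\<bar> * (\<bar>poly (cheb_T j) x\<bar> + 2 * \<bar>x\<bar> * \<bar>poly (cheb_T (j - 1)) x\<bar>)
          \<le> 2 * (real N * \<bar>x\<bar>) * 3"
        using abs_cheb_T_sum_le_3[OF x] by (intro mult_mono) auto
      then show ?thesis using C by linarith
    next
      case odd: False
      have "\<bar>poly (cheb_T j) x\<bar> \<le> real j * \<bar>x\<bar>"
        by (rule abs_cheb_T_odd_le[OF x odd])
      also have "\<dots> \<le> real N * \<bar>x\<bar>"
        using assms(2) by (intro mult_right_mono) auto
      finally have "\<bar>poly (cheb_T j) x\<bar> \<le> real N * \<bar>x\<bar>" .
      \<comment> \<open>\<open>T (j - 1)\<close> has even degree and need not be small; its
        prefactor \<open>x\<close> supplies the smallness.\<close>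
      moreover have "\<bar>x\<bar> * \<bar>poly (cheb_T (j - 1)) x\<bar> \<le> \<bar>x\<bar>"
        using abs_cheb_T_le_1[OF x] by (intro mult_left_le) auto
      ultimately have "\<bar>poly (cheb_T j) x\<bar> + 2 * \<bar>x\<bar> * \<bar>poly (cheb_T (j - 1)) x\<bar>
          \<le> 2 * (real N * \<bar>x\<bar>)"
        using \<open>2 * \<bar>x\<bar> \<le> real N * \<bar>x\<bar>\<close> by linarith
      then have "\<bar>cheb_U (N - j) x\<bar> * (\<bar>poly (cheb_T j) x\<bar> + 2 * \<bar>x\<bar> * \<bar>poly (cheb_T (j - 1)) x\<bar>)
          \<le> 2 * (2 * (real N * \<bar>x\<bar>))"
        using U_le_2 by (intro mult_mono) auto
      moreover have "0 \<le> real N * \<bar>x\<bar>" by simp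
      ultimately show ?thesis using C by linarith
    qed
  qed
qed

theorem mainTheorem6:
  shows "\<exists>c::real. c > 0 \<and> (\<forall>N::nat. N \<ge> 2 \<longrightarrow>
     cheb_backward_stable N (three_term_alg N) {-1..1} (c * (real N)\<^sup>2) \<and>
     cheb_backward_stable N (three_term_alg N)
       {x. \<bar>x\<bar> \<le> 1 / sqrt ((real N)\<^sup>2 + 1)} (c * real N))"
proof (intro exI[of _ 12] conjI allI impI)
  fix N :: nat
  assume N: "N \<ge> 2"
  have "cheb_backward_stable N (three_term_alg N) {-1..1} (12 * real N * real N)"
  proof (rule cheb_backward_stable_three_termI)
    fix x :: real and j
    assume "x \<in> {-1..1}" and j: "j \<in> {2..N}"
    then have x: "\<bar>x\<bar> \<le> 1" by auto
    have C: "0 \<le> cheb_C N x" by (simp add: cheb_C_def)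
    show "\<bar>cheb_U (N - j) x\<bar> * (\<bar>poly (cheb_T j) x\<bar> + 2 * \<bar>x\<bar> * \<bar>poly (cheb_T (j - 1)) x\<bar>)
        \<le> 12 * real N * cheb_C N x"
    \<comment> \<open>The two regimes overlap, so any threshold between them works; 1 also covers
      the second set, because \<open>1 / sqrt (N\<^sup>2 + 1)\<close> is at most
      \<open>1 / N\<close>.\<close>
    proof (cases "real N * \<bar>x\<bar> \<le> 1")
      case True
      have "12 * cheb_C N x \<le> 12 * real N * cheb_C N x"
        using N C by (intro mult_right_mono) auto
      then show ?thesis using error_term_le_small[OF N j True] by linarith
    next
      case False
      then have "1 \<le> (real N * \<bar>x\<bar>)\<^sup>2" by (intro one_le_power) simp
      then have "1 / 2 \<le> (real N)\<^sup>2 * x\<^sup>2" by (simp add: power_mult_distrib)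
      moreover have "6 * real N * cheb_C N x \<le> 12 * real N * cheb_C N x"
        using C by (intro mult_right_mono) auto
      ultimately show ?thesis using error_term_le_large[OF x j] by linarith
    qed
  qed (use N in auto)
  then show "cheb_backward_stable N (three_term_alg N) {-1..1} (12 * (real N)\<^sup>2)"
    by (simp add: power2_eq_square mult.assoc)
  have small: "real N * \<bar>x\<bar> \<le> 1" if "\<bar>x\<bar> \<le> 1 / sqrt ((real N)\<^sup>2 + 1)" for x
  proof -
    have "real N \<le> sqrt ((real N)\<^sup>2 + 1)"
      by (intro real_le_rsqrt) simp
    then have "real N * \<bar>x\<bar> \<le> sqrt ((real N)\<^sup>2 + 1) * (1 / sqrt ((real N)\<^sup>2 + 1))"
      using that by (intro mult_mono) auto
    also have "\<dots> = 1"
      by (simp add: add_nonneg_eq_0_iff)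
    finally show ?thesis .
  qed
  show "cheb_backward_stable N (three_term_alg N)
      {x. \<bar>x\<bar> \<le> 1 / sqrt ((real N)\<^sup>2 + 1)} (12 * real N)"
  proof (rule cheb_backward_stable_three_termI)
    show "{x. \<bar>x\<bar> \<le> 1 / sqrt ((real N)\<^sup>2 + 1)} \<subseteq> {-1..1}"
    proof
      fix x assume "x \<in> {x. \<bar>x\<bar> \<le> 1 / sqrt ((real N)\<^sup>2 + 1)}"
      then have "real N * \<bar>x\<bar> \<le> 1" using small by simp
      moreover have "1 * \<bar>x\<bar> \<le> real N * \<bar>x\<bar>"
        using N by (intro mult_right_mono) auto
      ultimately show "x \<in> {-1..1}" by auto
    qed
  qed (use N small error_term_le_small in auto)
qed simp

end
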